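(* Let $M=(\mathcal{S},\mathcal{A},p,r,\mu_0,\gamma)$ be a Markov decision process with strictly positive reward function $r(s,a)>0$ and discount factor $\gamma\in(0,1)$. Let $q(s'|s,a)$ be another transition dynamics on the same state and action spaces and let $\pi_c(a|s)$ be a (data collection) policy. For a policy $\pi$ define $$\mathcal{J}_M(\pi)=\mathbb{E}_{\tau\sim p^{\pi}}\Big[\sum_{t=0}^{\infty}\gamma^t r(s_t,a_t)\Big],\qquad \mathcal{L}(\pi)=\mathbb{E}_{\tau\sim q^{\pi_c}}\Big[\sum_{t=0}^{\infty}\gamma^t\,\tilde r(s_t,a_t,s_{t+1})\Big],$$ where the shifts-aware reward along a trajectory $\tau=(s_0,a_0,s_1,a_1,\dots)$ is $$\tilde r(s_t,a_t,s_{t+1})=\log r(s_t,a_t)+\frac{1}{(1-\gamma)\gamma^t}\left[\log\frac{p(s_{t+1}|s_t,a_t)}{q(s_{t+1}|s_t,a_t)}+\log\frac{\pi(a_t|s_t)}{\pi_c(a_t|s_t)}\right].$$ Then, for every policy $\pi$, $$\log\big[\mathcal{J}_M(\pi)\big]\ \ge\ (1-\gamma)\,\mathcal{L}(\pi).$$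
   Context: In $M=(\mathcal{S},\mathcal{A},p,r,\mu_0,\gamma)$, $\mathcal{S}$ is the state space, $\mathcal{A}$ the action space, $p(s'|s,a)$ the environment transition dynamics, $r$ the reward function, $\mu_0$ the initial state distribution and $\gamma$ the discount factor. For a transition dynamics $p$ and a policy $\pi$, $p^{\pi}$ denotes the probability distribution over infinite trajectories $\tau=(s_0,a_0,s_1,a_1,\dots)$ generated by $s_0\sim\mu_0$, $a_t\sim\pi(\cdot|s_t)$, $s_{t+1}\sim p(\cdot|s_t,a_t)$, formally written $p^{\pi}(\tau)=\mu_0(s_0)\prod_{t=0}^{\infty}p(s_{t+1}|s_t,a_t)\pi(a_t|s_t)$. Likewise $q^{\pi_c}(\tau)=\mu_0(s_0)\prod_{t=0}^{\infty}q(s_{t+1}|s_t,a_t)\pi_c(a_t|s_t)$ is the trajectory distribution generated by $\pi_c$ under dynamics $q$, with the same initial distribution $\mu_0$. Convention: all ratios, logarithms, infinite sums and expectations that appear are assumed to be well defined (denominators and arguments of logarithms are non-zero). *)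

theory Defs
  imports "HOL-Probability.Probability"
begin

text \<open>
  A Markov kernel given by its conditional density \<open>k x y\<close>, read \<open>k(y | x)\<close>, with respect to the
  reference measure \<open>N\<close>. Counting measure gives probability mass functions, Lebesgue measure gives
  probability density functions.
\<close>

definition conditional_density :: "'x measure \<Rightarrow> 'y measure \<Rightarrow> ('x \<Rightarrow> 'y \<Rightarrow> real) \<Rightarrow> bool" where
  "conditional_density X N k \<longleftrightarrow>
     (\<lambda>(x, y). k x y) \<in> borel_measurable (X \<Otimes>\<^sub>M N) \<and>
     (\<forall>x\<in>space X. (\<forall>y\<in>space N. 0 \<le> k x y) \<and> (\<integral>\<^sup>+y. ennreal (k x y) \<partial>N) = 1)"

abbreviation transition_dynamics ::
  "'s measure \<Rightarrow> 'a measure \<Rightarrow> ('s \<times> 'a \<Rightarrow> 's \<Rightarrow> real) \<Rightarrow> bool" where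
  "transition_dynamics S A p \<equiv> conditional_density (S \<Otimes>\<^sub>M A) S p"

abbreviation policy :: "'s measure \<Rightarrow> 'a measure \<Rightarrow> ('s \<Rightarrow> 'a \<Rightarrow> real) \<Rightarrow> bool" where
  "policy S A \<pi> \<equiv> conditional_density S A \<pi>"

text \<open>
  \<open>S\<close> and \<open>A\<close> are the state and action spaces together with the reference measures of the densities.
  The initial distribution \<open>\<mu>0\<close> is an arbitrary probability measure; it need not have a density.
\<close>

locale mdp =
  fixes S :: "'s measure" and A :: "'a measure"
    and p :: "'s \<times> 'a \<Rightarrow> 's \<Rightarrow> real" and r :: "'s \<times> 'a \<Rightarrow> real"
    and \<mu>0 :: "'s measure" and \<gamma> :: real
  assumes sigma_finite_states: "sigma_finite_measure S"
    and sigma_finite_actions: "sigma_finite_measure A"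
    and dynamics: "transition_dynamics S A p"
    and measurable_reward: "r \<in> borel_measurable (S \<Otimes>\<^sub>M A)"
    and prob_space_initial: "prob_space \<mu>0"
    and sets_initial: "sets \<mu>0 = sets S"
    and discount: "0 < \<gamma>" "\<gamma> < 1"

text \<open>Joint law of \<open>(s, a)\<close> for \<open>s \<sim> \<nu>\<close>, \<open>a \<sim> \<pi>(\<cdot> | s)\<close>.\<close>

definition state_action_dist ::
  "'a measure \<Rightarrow> ('s \<Rightarrow> 'a \<Rightarrow> real) \<Rightarrow> 's measure \<Rightarrow> ('s \<times> 'a) measure" where
  "state_action_dist A \<pi> \<nu> = density (\<nu> \<Otimes>\<^sub>M A) (\<lambda>(s, a). ennreal (\<pi> s a))"

text \<open>
  A trajectory \<open>\<tau> :: nat \<Rightarrow> 's \<times> 'a\<close> has \<open>\<tau> t = (s\<^sub>t, a\<^sub>t)\<close>. The kernel below is the law of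
  \<open>\<tau> n\<close> given \<open>\<tau> 0, \<dots>, \<tau> (n - 1)\<close>.
\<close>

definition trajectory_kernel ::
  "'s measure \<Rightarrow> 'a measure \<Rightarrow> 's measure \<Rightarrow> ('s \<times> 'a \<Rightarrow> 's \<Rightarrow> real) \<Rightarrow> ('s \<Rightarrow> 'a \<Rightarrow> real) \<Rightarrow>
   nat \<Rightarrow> (nat \<Rightarrow> 's \<times> 'a) \<Rightarrow> ('s \<times> 'a) measure" where
  "trajectory_kernel S A \<mu>0 p \<pi> n \<tau> = state_action_dist A \<pi>
     (case n of 0 \<Rightarrow> \<mu>0 | Suc t \<Rightarrow> density S (\<lambda>s'. ennreal (p (\<tau> t) s')))"

text \<open>
  The trajectory distribution \<open>p\<^sup>\<pi>\<close>: the Ionescu-Tulcea measure of these kernels on the infinite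
  product space.
\<close>

definition trajectory_dist ::
  "'s measure \<Rightarrow> 'a measure \<Rightarrow> 's measure \<Rightarrow> ('s \<times> 'a \<Rightarrow> 's \<Rightarrow> real) \<Rightarrow> ('s \<Rightarrow> 'a \<Rightarrow> real) \<Rightarrow>
   (nat \<Rightarrow> 's \<times> 'a) measure" where
  "trajectory_dist S A \<mu>0 p \<pi> = projective_family.lim UNIV
     (Ionescu_Tulcea.CI (trajectory_kernel S A \<mu>0 p \<pi>) (\<lambda>_. S \<Otimes>\<^sub>M A)) (\<lambda>_. S \<Otimes>\<^sub>M A)"

definition discounted_return :: "real \<Rightarrow> ('s \<times> 'a \<Rightarrow> real) \<Rightarrow> (nat \<Rightarrow> 's \<times> 'a) \<Rightarrow> real" where
  "discounted_return \<gamma> r \<tau> = (\<Sum>t. \<gamma> ^ t * r (\<tau> t))"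

definition expected_return ::
  "'s measure \<Rightarrow> 'a measure \<Rightarrow> ('s \<times> 'a \<Rightarrow> 's \<Rightarrow> real) \<Rightarrow> ('s \<times> 'a \<Rightarrow> real) \<Rightarrow> 's measure \<Rightarrow> real \<Rightarrow>
   ('s \<Rightarrow> 'a \<Rightarrow> real) \<Rightarrow> real" where
  "expected_return S A p r \<mu>0 \<gamma> \<pi> =
     (\<integral>\<tau>. discounted_return \<gamma> r \<tau> \<partial>trajectory_dist S A \<mu>0 p \<pi>)"

definition shifts_aware_reward ::
  "real \<Rightarrow> ('s \<times> 'a \<Rightarrow> real) \<Rightarrow> ('s \<times> 'a \<Rightarrow> 's \<Rightarrow> real) \<Rightarrow> ('s \<times> 'a \<Rightarrow> 's \<Rightarrow> real) \<Rightarrow>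
   ('s \<Rightarrow> 'a \<Rightarrow> real) \<Rightarrow> ('s \<Rightarrow> 'a \<Rightarrow> real) \<Rightarrow> nat \<Rightarrow> 's \<Rightarrow> 'a \<Rightarrow> 's \<Rightarrow> real" where
  "shifts_aware_reward \<gamma> r p q \<pi> \<pi>c t s a s' =
     ln (r (s, a)) +
     1 / ((1 - \<gamma>) * \<gamma> ^ t) * (ln (p (s, a) s' / q (s, a) s') + ln (\<pi> s a / \<pi>c s a))"

abbreviation shifts_aware_term ::
  "real \<Rightarrow> ('s \<times> 'a \<Rightarrow> real) \<Rightarrow> ('s \<times> 'a \<Rightarrow> 's \<Rightarrow> real) \<Rightarrow> ('s \<times> 'a \<Rightarrow> 's \<Rightarrow> real) \<Rightarrow>
   ('s \<Rightarrow> 'a \<Rightarrow> real) \<Rightarrow> ('s \<Rightarrow> 'a \<Rightarrow> real) \<Rightarrow> (nat \<Rightarrow> 's \<times> 'a) \<Rightarrow> nat \<Rightarrow> real" where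
  "shifts_aware_term \<gamma> r p q \<pi> \<pi>c \<tau> t \<equiv>
     \<gamma> ^ t * shifts_aware_reward \<gamma> r p q \<pi> \<pi>c t (fst (\<tau> t)) (snd (\<tau> t)) (fst (\<tau> (Suc t)))"

definition shifts_aware_return ::
  "real \<Rightarrow> ('s \<times> 'a \<Rightarrow> real) \<Rightarrow> ('s \<times> 'a \<Rightarrow> 's \<Rightarrow> real) \<Rightarrow> ('s \<times> 'a \<Rightarrow> 's \<Rightarrow> real) \<Rightarrow>
   ('s \<Rightarrow> 'a \<Rightarrow> real) \<Rightarrow> ('s \<Rightarrow> 'a \<Rightarrow> real) \<Rightarrow> (nat \<Rightarrow> 's \<times> 'a) \<Rightarrow> real" where
  "shifts_aware_return \<gamma> r p q \<pi> \<pi>c \<tau> = (\<Sum>t. shifts_aware_term \<gamma> r p q \<pi> \<pi>c \<tau> t)"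

definition surrogate_objective ::
  "'s measure \<Rightarrow> 'a measure \<Rightarrow> ('s \<times> 'a \<Rightarrow> 's \<Rightarrow> real) \<Rightarrow> ('s \<times> 'a \<Rightarrow> real) \<Rightarrow> 's measure \<Rightarrow> real \<Rightarrow>
   ('s \<times> 'a \<Rightarrow> 's \<Rightarrow> real) \<Rightarrow> ('s \<Rightarrow> 'a \<Rightarrow> real) \<Rightarrow> ('s \<Rightarrow> 'a \<Rightarrow> real) \<Rightarrow> real" where
  "surrogate_objective S A p r \<mu>0 \<gamma> q \<pi>c \<pi> =
     (\<integral>\<tau>. shifts_aware_return \<gamma> r p q \<pi> \<pi>c \<tau> \<partial>trajectory_dist S A \<mu>0 q \<pi>c)"

text \<open>
  The kernels do satisfy the hypotheses of the Ionescu-Tulcea theorem, so \<^const>\<open>trajectory_dist\<close>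
  is the intended probability measure.
\<close>

lemma prob_space_density_kernel:
  assumes "conditional_density X N k" "x \<in> space X"
  shows "prob_space (density N (\<lambda>y. ennreal (k x y)))"
proof (rule prob_spaceI)
  have [measurable]: "(\<lambda>y. k x y) \<in> borel_measurable N"
    using measurable_compose[OF measurable_Pair1'[OF assms(2)], of "\<lambda>(x, y). k x y"] assms(1)
    by (simp add: conditional_density_def)
  show "emeasure (density N (\<lambda>y. ennreal (k x y))) (space (density N (\<lambda>y. ennreal (k x y)))) = 1"
    using assms by (simp add: emeasure_density conditional_density_def
        cong: nn_integral_cong)
qed

lemma nn_integral_state_action_dist:
  assumes "sigma_finite_measure A" "policy S A \<pi>" "prob_space \<nu>" "sets \<nu> = sets S"
    and f: "f \<in> borel_measurable (S \<Otimes>\<^sub>M A)"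
  shows "(\<integral>\<^sup>+x. f x \<partial>state_action_dist A \<pi> \<nu>) =
         (\<integral>\<^sup>+s. \<integral>\<^sup>+a. ennreal (\<pi> s a) * f (s, a) \<partial>A \<partial>\<nu>)"
proof -
  interpret A: sigma_finite_measure A by fact
  note [measurable_cong] = assms(4)
  note [measurable] = f
  have [measurable]: "(\<lambda>(s, a). \<pi> s a) \<in> borel_measurable (S \<Otimes>\<^sub>M A)"
    using assms(2) by (simp add: conditional_density_def)
  show ?thesis
    unfolding state_action_dist_def
    by (subst nn_integral_density, measurable)
       (simp add: A.nn_integral_fst[symmetric])
qed

lemma sets_state_action_dist:
  "sets \<nu> = sets S \<Longrightarrow> sets (state_action_dist A \<pi> \<nu>) = sets (S \<Otimes>\<^sub>M A)"
  by (simp add: state_action_dist_def cong: sets_pair_measure_cong)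

lemma prob_space_state_action_dist:
  assumes "sigma_finite_measure A" "policy S A \<pi>" "prob_space \<nu>" "sets \<nu> = sets S"
  shows "prob_space (state_action_dist A \<pi> \<nu>)"
proof (rule prob_spaceI)
  interpret nu: prob_space \<nu> by fact
  have "emeasure (state_action_dist A \<pi> \<nu>) (space (state_action_dist A \<pi> \<nu>)) =
        (\<integral>\<^sup>+x. 1 \<partial>state_action_dist A \<pi> \<nu>)"
    by simp
  also have "\<dots> = (\<integral>\<^sup>+s. \<integral>\<^sup>+a. ennreal (\<pi> s a) \<partial>A \<partial>\<nu>)"
    by (subst nn_integral_state_action_dist[OF assms]) auto
  also have "\<dots> = (\<integral>\<^sup>+s. 1 \<partial>\<nu>)"
    using assms(2) sets_eq_imp_space_eq[OF assms(4)]
    by (intro nn_integral_cong) (simp add: conditional_density_def)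
  finally show "emeasure (state_action_dist A \<pi> \<nu>) (space (state_action_dist A \<pi> \<nu>)) = 1"
    by (simp add: nu.emeasure_space_1)
qed

lemma Ionescu_Tulcea_trajectory:
  assumes "mdp S A p r \<mu>0 \<gamma>" "transition_dynamics S A q" "policy S A \<pi>"
  shows "Ionescu_Tulcea (trajectory_kernel S A \<mu>0 q \<pi>) (\<lambda>_. S \<Otimes>\<^sub>M A)"
proof -
  interpret M: mdp S A p r \<mu>0 \<gamma> by fact
  interpret SS: sigma_finite_measure S by (rule M.sigma_finite_states)
  interpret AA: sigma_finite_measure A by (rule M.sigma_finite_actions)
  have [measurable]: "(\<lambda>(x, y). q x y) \<in> borel_measurable ((S \<Otimes>\<^sub>M A) \<Otimes>\<^sub>M S)"
    and [measurable]: "(\<lambda>(s, a). \<pi> s a) \<in> borel_measurable (S \<Otimes>\<^sub>M A)"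
    using assms(2,3) by (simp_all add: conditional_density_def)
  define \<nu> where "\<nu> n \<tau> = (case n of 0 \<Rightarrow> \<mu>0 | Suc t \<Rightarrow> density S (\<lambda>s'. ennreal (q (\<tau> t) s')))"
    for n and \<tau> :: "nat \<Rightarrow> 'a \<times> 'b"
  have K: "trajectory_kernel S A \<mu>0 q \<pi> n \<tau> = state_action_dist A \<pi> (\<nu> n \<tau>)" for n \<tau>
    by (simp add: trajectory_kernel_def \<nu>_def)
  have sets_\<nu>: "sets (\<nu> n \<tau>) = sets S" for n \<tau>
    by (simp add: \<nu>_def M.sets_initial split: nat.split)
  have prob_\<nu>: "prob_space (\<nu> n \<tau>)" if "\<tau> \<in> space (PiM {0..<n} (\<lambda>_. S \<Otimes>\<^sub>M A))" for n \<tau>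
  proof (cases n)
    case (Suc t)
    then have "\<tau> t \<in> space (S \<Otimes>\<^sub>M A)"
      using that by (auto simp: space_PiM PiE_iff)
    then show ?thesis
      using prob_space_density_kernel[OF assms(2)] by (simp add: \<nu>_def Suc)
  qed (simp add: \<nu>_def M.prob_space_initial)
  have prob: "prob_space (trajectory_kernel S A \<mu>0 q \<pi> n \<tau>)"
    if "\<tau> \<in> space (PiM {0..<n} (\<lambda>_. S \<Otimes>\<^sub>M A))" for n \<tau>
    unfolding K using M.sigma_finite_actions assms(3) prob_\<nu>[OF that] sets_\<nu>
    by (rule prob_space_state_action_dist)
  show ?thesis
  proof (rule Ionescu_Tulcea.intro)
    fix n
    show "trajectory_kernel S A \<mu>0 q \<pi> n \<in>
            measurable (PiM {0..<n} (\<lambda>_. S \<Otimes>\<^sub>M A)) (subprob_algebra (S \<Otimes>\<^sub>M A))"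
    proof (rule measurable_subprob_algebra)
      fix B assume [measurable]: "B \<in> sets (S \<Otimes>\<^sub>M A)"
      define h where "h s = (\<integral>\<^sup>+a. ennreal (\<pi> s a) * indicator B (s, a) \<partial>A)" for s
      have h[measurable]: "h \<in> borel_measurable S"
        unfolding h_def by measurable
      have eq: "emeasure (trajectory_kernel S A \<mu>0 q \<pi> n \<tau>) B = (\<integral>\<^sup>+s. h s \<partial>\<nu> n \<tau>)"
        if "\<tau> \<in> space (PiM {0..<n} (\<lambda>_. S \<Otimes>\<^sub>M A))" for \<tau>
        using nn_integral_state_action_dist[OF M.sigma_finite_actions assms(3) prob_\<nu>[OF that]
            sets_\<nu>, of "indicator B"] sets_state_action_dist[OF sets_\<nu>, of A \<pi> n \<tau>]
        by (simp add: K h_def)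
      have "(\<lambda>\<tau>. \<integral>\<^sup>+s. h s \<partial>\<nu> n \<tau>) \<in> borel_measurable (PiM {0..<n} (\<lambda>_. S \<Otimes>\<^sub>M A))"
      proof (cases n)
        case (Suc t)
        have 1: "(\<integral>\<^sup>+s. h s \<partial>\<nu> n \<tau>) = (\<integral>\<^sup>+s. ennreal (q (\<tau> t) s) * h s \<partial>S)"
          if "\<tau> \<in> space (PiM {0..<n} (\<lambda>_. S \<Otimes>\<^sub>M A))" for \<tau>
        proof -
          have [measurable]: "\<tau> t \<in> space (S \<Otimes>\<^sub>M A)"
            using that by (auto simp: space_PiM PiE_iff Suc)
          show ?thesis
            by (simp add: \<nu>_def Suc nn_integral_density)
        qed
        have [measurable]: "t \<in> {0..<n}" by (simp add: Suc)
        have "(\<lambda>\<tau>. \<integral>\<^sup>+s. ennreal (q (\<tau> t) s) * h s \<partial>S) \<in>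
                borel_measurable (PiM {0..<n} (\<lambda>_. S \<Otimes>\<^sub>M A))"
          by measurable
        then show ?thesis
          using 1 by (simp cong: measurable_cong)
      qed (simp add: \<nu>_def)
      then show "(\<lambda>\<tau>. emeasure (trajectory_kernel S A \<mu>0 q \<pi> n \<tau>) B) \<in>
                   borel_measurable (PiM {0..<n} (\<lambda>_. S \<Otimes>\<^sub>M A))"
        using eq by (simp cong: measurable_cong)
    qed (auto simp: K sets_state_action_dist[OF sets_\<nu>] intro!: prob_space_imp_subprob_space prob[unfolded K])
  qed (rule prob)
qed

end

theory Submission
  imports Defs
begin

text \<open>
  Let \<open>Z\<^sub>n\<close> be the exponential of \<open>1 - \<gamma>\<close> times the \<open>n\<close>-th partial sum of the shifts-aware return. It
  is the likelihood ratio of \<open>p\<^sup>\<pi>\<close> to \<open>q\<^bsup>\<pi>c\<^esup>\<close> on the first \<open>n\<close> steps times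
  \<open>\<Prod>t<n. r (s\<^sub>t, a\<^sub>t) powr ((1 - \<gamma>) * \<gamma> ^ t)\<close>. The exponents have sum \<open>1 - \<gamma> ^ n\<close>, so after the change of
  measure the weighted AM-GM inequality bounds the expectation of \<open>Z\<^sub>n\<close> by
  \<open>(1 - \<gamma>) * J + \<gamma> ^ n\<close>. Jensen's inequality and Fatou's lemma then give
  \<open>exp ((1 - \<gamma>) * L) \<le> (1 - \<gamma>) * J\<close>, which is stronger than the claim. Only finite-horizon likelihood
  ratios occur, so no absolute continuity between the laws of infinite trajectories is needed.
\<close>

section \<open>Finite-horizon integrals and change of kernel for Ionescu-Tulcea measures\<close>

context Ionescu_Tulcea
begin

text \<open>The first \<open>n\<close> coordinates of the limit measure are distributed as the
  \<open>n\<close>-fold composition of the kernels: \<open>up_to {0..<n}\<close> is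
  \<open>n\<close>, so the projection inside \<open>CI\<close> acts as the identity.\<close>

lemma nn_integral_lim_restrict:
  assumes f[measurable]: "f \<in> borel_measurable (PiM {0..<n} M)"
  shows "(\<integral>\<^sup>+\<tau>. f (restrict \<tau> {0..<n}) \<partial>PF.lim) = (\<integral>\<^sup>+\<omega>. f \<omega> \<partial>C 0 n (\<lambda>_. undefined))"
proof -
  have u: "up_to {0..<n} = n"
    unfolding up_to_def by (rule Least_equality) (auto simp: not_less[symmetric])
  have sets_C0: "sets (C 0 n (\<lambda>_. undefined)) = sets (PiM {0..<n} M)"
    by (subst sets_C) (auto simp: space_PiM)
  have sp: "restrict \<omega> {0..<n} = \<omega>" if "\<omega> \<in> space (C 0 n (\<lambda>_. undefined))" for \<omega>
    using that by (auto simp: sets_eq_imp_space_eq[OF sets_C0] space_PiM PiE_iff extensional_restrict)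
  have "(\<integral>\<^sup>+\<tau>. f (restrict \<tau> {0..<n}) \<partial>PF.lim) = (\<integral>\<^sup>+\<omega>. f \<omega> \<partial>CI {0..<n})"
    by (subst distr_lim[symmetric], simp, subst nn_integral_distr)
       (auto simp: measurable_cong_sets[OF PF.sets_lim refl] intro!: measurable_restrict_subset)
  also have "\<dots> = (\<integral>\<^sup>+\<omega>. f (restrict \<omega> {0..<n}) \<partial>C 0 n (\<lambda>_. undefined))"
    unfolding CI_def u
    by (subst nn_integral_distr)
       (auto simp: measurable_cong_sets[OF sets_C0 refl] intro!: measurable_restrict_subset)
  also have "\<dots> = (\<integral>\<^sup>+\<omega>. f \<omega> \<partial>C 0 n (\<lambda>_. undefined))"
    by (intro nn_integral_cong) (simp add: sp)
  finally show ?thesis .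
qed

text \<open>The whole space is the cylinder over the empty index set, so its mass is that of
  \<open>CI {}\<close>.\<close>

lemma prob_space_lim: "prob_space PF.lim"
proof (rule prob_spaceI)
  have "space PF.lim = PF.emb UNIV {} (space (PiM {} M))"
    by (auto simp: PF.space_lim prod_emb_def space_PiM)
  also have "emeasure PF.lim \<dots> = emeasure (CI {}) (space (PiM {} M))"
    by (rule lim) auto
  also have "\<dots> = 1"
    using prob_space.emeasure_space_1[OF PF.prob_space_P[of "{}"]] by (simp add: PF.space_P)
  finally show "emeasure PF.lim (space PF.lim) = 1" .
qed

text \<open>Disintegration of the last coordinate: \<open>C 0 (Suc n)\<close> is the bind of
  \<open>C 0 n\<close> with \<open>eP n\<close>, which appends a sample of \<open>P n\<close>.
  Inductions over the horizon rest on this identity.\<close>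

lemma nn_integral_lim_Suc:
  assumes f[measurable]: "f \<in> borel_measurable (PiM {0..<Suc n} M)"
  shows "(\<integral>\<^sup>+\<tau>. f (restrict \<tau> {0..<Suc n}) \<partial>PF.lim) =
    (\<integral>\<^sup>+\<tau>. (\<integral>\<^sup>+y. f (fun_upd (restrict \<tau> {0..<n}) n y) \<partial>P n (restrict \<tau> {0..<n})) \<partial>PF.lim)"
proof -
  define h where "h \<omega> = (\<integral>\<^sup>+\<xi>. f \<xi> \<partial>eP n \<omega>)" for \<omega>
  have h[measurable]: "h \<in> borel_measurable (PiM {0..<n} M)"
    unfolding h_def
    by (rule measurable_compose[OF measurable_eP nn_integral_measurable_subprob_algebra[OF f]])
  have u: "(\<lambda>_. undefined) \<in> space (PiM {0..<0} M)"
    by (simp add: space_PiM)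
  have eP0: "eP n \<in> measurable (C 0 n (\<lambda>_. undefined)) (subprob_algebra (PiM {0..<Suc n} M))"
    using measurable_eP by (simp add: measurable_cong_sets[OF sets_C[OF u] refl])
  have "(\<integral>\<^sup>+\<tau>. f (restrict \<tau> {0..<Suc n}) \<partial>PF.lim) = (\<integral>\<^sup>+\<omega>. f \<omega> \<partial>C 0 (Suc n) (\<lambda>_. undefined))"
    by (rule nn_integral_lim_restrict) fact
  also have "\<dots> = (\<integral>\<^sup>+\<omega>. h \<omega> \<partial>C 0 n (\<lambda>_. undefined))"
    unfolding h_def using eP0
    by (simp add: nn_integral_bind[OF f])
  also have "\<dots> = (\<integral>\<^sup>+\<tau>. h (restrict \<tau> {0..<n}) \<partial>PF.lim)"
    by (rule nn_integral_lim_restrict[symmetric]) fact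
  also have "\<dots> = (\<integral>\<^sup>+\<tau>. (\<integral>\<^sup>+y. f (fun_upd (restrict \<tau> {0..<n}) n y) \<partial>P n (restrict \<tau> {0..<n})) \<partial>PF.lim)"
    unfolding h_def
    by (intro nn_integral_cong nn_integral_eP f) (auto simp: PF.space_lim space_PiM)
  finally show ?thesis .
qed

end

text \<open>
  Only \<open>\<le>\<close> can hold in general: \<open>W n\<close> does not see the part of the second law that is singular to the
  first.
\<close>

lemma nn_integral_lim_change_of_kernel:
  assumes K: "Ionescu_Tulcea K M" and L: "Ionescu_Tulcea L M"
    and W: "\<And>n. W n \<in> borel_measurable (PiM {0..<n} M)"
    and W0: "\<And>\<omega>. W 0 \<omega> \<le> (1::ennreal)"
    and step: "\<And>n \<omega> g. \<omega> \<in> space (PiM {0..<n} M) \<Longrightarrow> g \<in> borel_measurable (M n) \<Longrightarrow>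
      (\<integral>\<^sup>+y. W (Suc n) (fun_upd \<omega> n y) * g y \<partial>K n \<omega>) \<le> W n \<omega> * (\<integral>\<^sup>+y. g y \<partial>L n \<omega>)"
    and f: "f \<in> borel_measurable (PiM {0..<n} M)"
  shows "(\<integral>\<^sup>+\<tau>. W n (restrict \<tau> {0..<n}) * f (restrict \<tau> {0..<n})
            \<partial>projective_family.lim UNIV (Ionescu_Tulcea.CI K M) M) \<le>
         (\<integral>\<^sup>+\<tau>. f (restrict \<tau> {0..<n}) \<partial>projective_family.lim UNIV (Ionescu_Tulcea.CI L M) M)"
proof -
  interpret K: Ionescu_Tulcea K M by fact
  interpret L: Ionescu_Tulcea L M by fact
  note W[measurable]
  show ?thesis
    using f
  proof (induction n arbitrary: f)
    case 0
    interpret KP: prob_space K.PF.lim by (rule K.prob_space_lim)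
    interpret LP: prob_space L.PF.lim by (rule L.prob_space_lim)
    show ?case
      using mult_right_mono[OF W0[of "\<lambda>_. undefined"], of "f (\<lambda>_. undefined)"]
      by (simp add: restrict_def KP.emeasure_space_1 LP.emeasure_space_1 del: K.PF.space_lim L.PF.space_lim)
  next
    case (Suc n)
    note [measurable] = Suc.prems
    \<comment> \<open>Integrating out the last coordinate under \<open>L\<close> yields a test
      function of the first \<open>n\<close> coordinates. The induction hypothesis must apply to it,
      hence the generalization over \<open>f\<close>.\<close>
    define h where "h \<omega> = (\<integral>\<^sup>+y. f (fun_upd \<omega> n y) \<partial>L n \<omega>)" for \<omega>
    have upd: "(\<lambda>(\<omega>, y). f (fun_upd \<omega> n y)) \<in> borel_measurable (PiM {0..<n} M \<Otimes>\<^sub>M M n)"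
      using measurable_compose[OF measurable_add_dim[of n "{0..<n}" M], of f] Suc.prems
      by (simp add: atLeast0_lessThan_Suc split_beta')
    have h: "h \<in> borel_measurable (PiM {0..<n} M)"
      unfolding h_def using upd L.P by (rule nn_integral_measurable_subprob_algebra2)
    have "(\<integral>\<^sup>+\<tau>. W (Suc n) (restrict \<tau> {0..<Suc n}) * f (restrict \<tau> {0..<Suc n}) \<partial>K.PF.lim) =
      (\<integral>\<^sup>+\<tau>. (\<integral>\<^sup>+y. W (Suc n) (fun_upd (restrict \<tau> {0..<n}) n y) * f (fun_upd (restrict \<tau> {0..<n}) n y)
          \<partial>K n (restrict \<tau> {0..<n})) \<partial>K.PF.lim)"
      by (rule K.nn_integral_lim_Suc) measurable
    also have "\<dots> \<le> (\<integral>\<^sup>+\<tau>. W n (restrict \<tau> {0..<n}) * h (restrict \<tau> {0..<n}) \<partial>K.PF.lim)"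
    proof (intro nn_integral_mono, unfold h_def, rule step)
      fix \<tau> assume "\<tau> \<in> space K.PF.lim"
      then show \<tau>: "restrict \<tau> {0..<n} \<in> space (PiM {0..<n} M)"
        by (auto simp: K.PF.space_lim space_PiM)
      show "(\<lambda>y. f (fun_upd (restrict \<tau> {0..<n}) n y)) \<in> borel_measurable (M n)"
        using measurable_compose[OF measurable_Pair1'[OF \<tau>] upd] by simp
    qed
    also have "\<dots> \<le> (\<integral>\<^sup>+\<tau>. h (restrict \<tau> {0..<n}) \<partial>L.PF.lim)"
      by (rule Suc.IH) fact
    also have "\<dots> = (\<integral>\<^sup>+\<tau>. f (restrict \<tau> {0..<Suc n}) \<partial>L.PF.lim)"
      unfolding h_def by (rule L.nn_integral_lim_Suc[symmetric]) fact
    finally show ?case .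
  qed
qed

section \<open>Convexity inequalities for the exponential function\<close>

text \<open>The graph of \<open>exp\<close> lies above its tangent at \<open>m\<close>. Averaging
  over \<open>x\<close> with mean \<open>m\<close> turns the left side into \<open>exp m\<close>,
  which gives both inequalities that follow.\<close>

lemma exp_ge_tangent: "exp m * (1 + x - m) \<le> exp (x::real)"
  using mult_left_mono[OF exp_ge_add_one_self[of "x - m"], of "exp m"]
  by (simp add: exp_diff algebra_simps)

text \<open>Jensen's inequality with an extended right side, so that no integrability of
  \<open>exp X\<close> has to be established beforehand.\<close>

lemma (in prob_space) jensen_exp_nn_integral:
  fixes X :: "'a \<Rightarrow> real"
  assumes X: "integrable M X"
  shows "ennreal (exp (expectation X)) \<le> (\<integral>\<^sup>+x. ennreal (exp (X x)) \<partial>M)"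
proof -
  define m where "m = expectation X"
  define Y where "Y x = exp m * (1 + X x - m)" for x
  have Y: "integrable M Y" "expectation Y = exp m"
    unfolding Y_def using X by (auto simp: m_def prob_space)
  have "ennreal (exp m) = ennreal (expectation Y)" by (simp add: Y)
  \<comment> \<open>The tangent can be negative. Truncation at 0 keeps it below \<open>exp\<close>
    and permits the passage to a nonnegative integral.\<close>
  also have "\<dots> \<le> ennreal (\<integral>x. max 0 (Y x) \<partial>M)"
    using Y by (intro ennreal_leI integral_mono) auto
  also have "\<dots> = (\<integral>\<^sup>+x. ennreal (max 0 (Y x)) \<partial>M)"
    using Y by (intro nn_integral_eq_integral[symmetric]) auto
  also have "\<dots> \<le> (\<integral>\<^sup>+x. ennreal (exp (X x)) \<partial>M)"
    unfolding Y_def using exp_ge_tangent by (intro nn_integral_mono ennreal_leI) auto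
  finally show ?thesis by (simp add: m_def)
qed

text \<open>Weighted AM-GM for the numbers \<open>exp (x i)\<close>, obtained by averaging the
  tangent at the weighted mean. The missing weight \<open>1 - sum w I\<close> is placed at the point
  0, where \<open>exp\<close> is 1; this does not change the mean.\<close>

lemma exp_weighted_sum_le:
  fixes w x :: "'i \<Rightarrow> real"
  assumes "\<And>i. i \<in> I \<Longrightarrow> 0 \<le> w i" "sum w I \<le> 1"
  shows "exp (\<Sum>i\<in>I. w i * x i) \<le> (\<Sum>i\<in>I. w i * exp (x i)) + (1 - sum w I)"
proof -
  define m where "m = (\<Sum>i\<in>I. w i * x i)"
  have eq: "(\<Sum>i\<in>I. w i * (exp m * (1 + x i - m))) = exp m * (sum w I * (1 - m) + m)"
  proof -
    have "(\<Sum>i\<in>I. w i * (exp m * (1 + x i - m))) =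
        (\<Sum>i\<in>I. exp m * (w i * (1 - m)) + exp m * (w i * x i))"
      by (simp add: algebra_simps)
    also have "\<dots> = exp m * (sum w I * (1 - m)) + exp m * (\<Sum>i\<in>I. w i * x i)"
      by (simp only: sum.distrib sum_distrib_left sum_distrib_right)
    finally show ?thesis by (simp add: m_def distrib_left)
  qed
  have "exp m = (\<Sum>i\<in>I. w i * (exp m * (1 + x i - m))) + (1 - sum w I) * (exp m * (1 + 0 - m))"
    unfolding eq by (simp add: algebra_simps)
  also have "\<dots> \<le> (\<Sum>i\<in>I. w i * exp (x i)) + (1 - sum w I) * exp 0"
    using assms by (intro add_mono sum_mono mult_left_mono exp_ge_tangent) auto
  finally show ?thesis by (simp add: m_def)
qed


section \<open>Likelihood ratios of finite trajectory segments\<close>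

text \<open>
  The ratio for the first \<open>n\<close> state-action pairs; the transition out of the last pair is left out, so
  it is a function of \<open>\<tau> 0, \<dots>, \<tau> (n - 1)\<close> alone.
\<close>

definition likelihood_ratio ::
  "('s \<times> 'a \<Rightarrow> 's \<Rightarrow> real) \<Rightarrow> ('s \<times> 'a \<Rightarrow> 's \<Rightarrow> real) \<Rightarrow> ('s \<Rightarrow> 'a \<Rightarrow> real) \<Rightarrow>
   ('s \<Rightarrow> 'a \<Rightarrow> real) \<Rightarrow> nat \<Rightarrow> (nat \<Rightarrow> 's \<times> 'a) \<Rightarrow> real" where
  "likelihood_ratio p q \<pi> \<pi>c n \<tau> =
     (\<Prod>i<n. \<pi> (fst (\<tau> i)) (snd (\<tau> i)) / \<pi>c (fst (\<tau> i)) (snd (\<tau> i))) *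
     (\<Prod>i<n - 1. p (\<tau> i) (fst (\<tau> (Suc i))) / q (\<tau> i) (fst (\<tau> (Suc i))))"

text \<open>The factor \<open>q\<close> cancels wherever it is nonzero. Where it vanishes, the left
  integrand is 0, which loses the mass that \<open>p\<close> may have there.\<close>

lemma nn_integral_density_ratio_le:
  assumes q[measurable]: "q \<in> borel_measurable N"
    and p[measurable]: "p \<in> borel_measurable N" and h[measurable]: "h \<in> borel_measurable N"
    and q_nonneg: "\<And>x. x \<in> space N \<Longrightarrow> (0::real) \<le> q x"
  shows "(\<integral>\<^sup>+x. ennreal (p x / q x) * h x \<partial>density N (\<lambda>x. ennreal (q x))) \<le>
         (\<integral>\<^sup>+x. h x \<partial>density N (\<lambda>x. ennreal (p x)))"
proof -
  have "ennreal (q x) * (ennreal (p x / q x) * h x) \<le> ennreal (p x) * h x" if "x \<in> space N" for x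
  proof (cases "q x = 0")
    case False
    then show ?thesis
      using q_nonneg[OF that] by (simp add: mult.assoc[symmetric] ennreal_mult'[symmetric])
  qed simp
  then show ?thesis
    by (simp add: nn_integral_density nn_integral_mono)
qed

context mdp
begin

lemma measurable_dynamics:
  assumes "transition_dynamics S A q"
  shows "(\<lambda>(x, y). q x y) \<in> borel_measurable ((S \<Otimes>\<^sub>M A) \<Otimes>\<^sub>M S)"
  using assms by (simp add: conditional_density_def)

lemma measurable_policy:
  assumes "policy S A \<pi>"
  shows "(\<lambda>(s, a). \<pi> s a) \<in> borel_measurable (S \<Otimes>\<^sub>M A)"
  using assms by (simp add: conditional_density_def)

text \<open>Lifts a change of state law to a change of state-action law: the policy ratio cancels
  \<open>\<pi>c\<close> for each fixed state, and \<open>le\<close> handles the remaining state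
  integral. The state laws are kept abstract so that the initial step and all later steps are
  covered at once.\<close>

lemma state_action_dist_ratio_le:
  assumes \<pi>c: "policy S A \<pi>c" and \<pi>: "policy S A \<pi>"
    and \<nu>: "prob_space \<nu>" "sets \<nu> = sets S" and \<nu>': "prob_space \<nu>'" "sets \<nu>' = sets S"
    and u[measurable]: "u \<in> borel_measurable S" and g[measurable]: "g \<in> borel_measurable (S \<Otimes>\<^sub>M A)"
    and le: "\<And>h. h \<in> borel_measurable S \<Longrightarrow> (\<integral>\<^sup>+s. u s * h s \<partial>\<nu>) \<le> (\<integral>\<^sup>+s. h s \<partial>\<nu>')"
  shows "(\<integral>\<^sup>+x. ennreal (\<pi> (fst x) (snd x) / \<pi>c (fst x) (snd x)) * u (fst x) * g x
            \<partial>state_action_dist A \<pi>c \<nu>) \<le> (\<integral>\<^sup>+x. g x \<partial>state_action_dist A \<pi> \<nu>')"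
proof -
  interpret A: sigma_finite_measure A by (rule sigma_finite_actions)
  note [measurable] = measurable_policy[OF \<pi>c] measurable_policy[OF \<pi>]
  define h where "h s = (\<integral>\<^sup>+a. ennreal (\<pi> s a) * g (s, a) \<partial>A)" for s
  have h[measurable]: "h \<in> borel_measurable S"
    unfolding h_def by measurable
  have 1: "ennreal (\<pi>c s a) * (ennreal (\<pi> s a / \<pi>c s a) * u s * g (s, a)) \<le>
      u s * (ennreal (\<pi> s a) * g (s, a))" if "s \<in> space S" "a \<in> space A" for s a
  proof (cases "\<pi>c s a = 0")
    case False
    moreover have "0 \<le> \<pi>c s a"
      using \<pi>c that by (simp add: conditional_density_def)
    ultimately have "ennreal (\<pi>c s a) * ennreal (\<pi> s a / \<pi>c s a) = ennreal (\<pi> s a)"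
      by (simp add: ennreal_mult'[symmetric])
    then show ?thesis by (simp add: mult.assoc[symmetric]) (simp add: mult_ac)
  qed simp
  have "(\<integral>\<^sup>+x. ennreal (\<pi> (fst x) (snd x) / \<pi>c (fst x) (snd x)) * u (fst x) * g x
            \<partial>state_action_dist A \<pi>c \<nu>) =
     (\<integral>\<^sup>+s. \<integral>\<^sup>+a. ennreal (\<pi>c s a) * (ennreal (\<pi> s a / \<pi>c s a) * u s * g (s, a)) \<partial>A \<partial>\<nu>)"
    by (subst nn_integral_state_action_dist[OF sigma_finite_actions \<pi>c \<nu>]) simp_all
  also have "\<dots> \<le> (\<integral>\<^sup>+s. \<integral>\<^sup>+a. u s * (ennreal (\<pi> s a) * g (s, a)) \<partial>A \<partial>\<nu>)"
    using 1 sets_eq_imp_space_eq[OF \<nu>(2)] by (intro nn_integral_mono) auto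
  also have "\<dots> = (\<integral>\<^sup>+s. u s * h s \<partial>\<nu>)"
    unfolding h_def using sets_eq_imp_space_eq[OF \<nu>(2)]
    by (intro nn_integral_cong nn_integral_cmult) simp
  also have "\<dots> \<le> (\<integral>\<^sup>+s. h s \<partial>\<nu>')"
    by (rule le) fact
  also have "\<dots> = (\<integral>\<^sup>+x. g x \<partial>state_action_dist A \<pi> \<nu>')"
    unfolding h_def by (rule nn_integral_state_action_dist[OF sigma_finite_actions \<pi> \<nu>' g, symmetric])
  finally show ?thesis .
qed

lemma measurable_likelihood_ratio:
  assumes q: "transition_dynamics S A q" and \<pi>c: "policy S A \<pi>c" and \<pi>: "policy S A \<pi>"
    and I: "{..<n} \<subseteq> I"
  shows "likelihood_ratio p q \<pi> \<pi>c n \<in> borel_measurable (PiM I (\<lambda>_. S \<Otimes>\<^sub>M A))"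
proof -
  note [measurable] = measurable_policy[OF \<pi>c] measurable_policy[OF \<pi>]
    measurable_dynamics[OF q] measurable_dynamics[OF dynamics]
  have C: "(\<lambda>\<tau>. \<tau> i) \<in> measurable (PiM I (\<lambda>_. S \<Otimes>\<^sub>M A)) (S \<Otimes>\<^sub>M A)" if "i < n" for i
    using that I by (intro measurable_component_singleton) auto
  have [measurable]: "(\<lambda>\<tau>. \<pi> (fst (\<tau> i)) (snd (\<tau> i)) / \<pi>c (fst (\<tau> i)) (snd (\<tau> i)))
      \<in> borel_measurable (PiM I (\<lambda>_. S \<Otimes>\<^sub>M A))" if "i < n" for i
    using C[OF that] by measurable
  have [measurable]: "(\<lambda>\<tau>. p (\<tau> i) (fst (\<tau> (Suc i))) / q (\<tau> i) (fst (\<tau> (Suc i))))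
      \<in> borel_measurable (PiM I (\<lambda>_. S \<Otimes>\<^sub>M A))" if "i < n - 1" for i
  proof -
    have [measurable]: "(\<lambda>\<tau>. \<tau> i) \<in> measurable (PiM I (\<lambda>_. S \<Otimes>\<^sub>M A)) (S \<Otimes>\<^sub>M A)"
      "(\<lambda>\<tau>. \<tau> (Suc i)) \<in> measurable (PiM I (\<lambda>_. S \<Otimes>\<^sub>M A)) (S \<Otimes>\<^sub>M A)"
      using that by (auto intro!: C)
    show ?thesis by measurable
  qed
  show ?thesis
    unfolding likelihood_ratio_def[abs_def]
    by (intro borel_measurable_times borel_measurable_prod) auto
qed


lemma likelihood_ratio_nonneg:
  assumes q: "transition_dynamics S A q" and \<pi>c: "policy S A \<pi>c" and \<pi>: "policy S A \<pi>"
    and \<tau>: "\<And>i. i < n \<Longrightarrow> \<tau> i \<in> space (S \<Otimes>\<^sub>M A)"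
  shows "0 \<le> likelihood_ratio p q \<pi> \<pi>c n \<tau>"
proof -
  have "0 \<le> \<pi> (fst (\<tau> i)) (snd (\<tau> i)) / \<pi>c (fst (\<tau> i)) (snd (\<tau> i))" if "i < n" for i
    using \<tau>[OF that] \<pi> \<pi>c by (auto simp: conditional_density_def space_pair_measure)
  moreover have "0 \<le> p (\<tau> i) (fst (\<tau> (Suc i))) / q (\<tau> i) (fst (\<tau> (Suc i)))" if "i < n - 1" for i
  proof -
    have "\<tau> i \<in> space (S \<Otimes>\<^sub>M A)" "fst (\<tau> (Suc i)) \<in> space S"
      using \<tau>[of i] \<tau>[of "Suc i"] that by (auto simp: space_pair_measure mem_Times_iff)
    then show ?thesis
      using q dynamics by (simp add: conditional_density_def)
  qed
  ultimately show ?thesis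
    unfolding likelihood_ratio_def by (intro mult_nonneg_nonneg prod_nonneg) auto
qed

text \<open>Appending a pair brings in its policy ratio and the ratio of the transition into its
  state. For \<open>n = 0\<close> the second factor is 1, since both laws start from
  \<open>\<mu>0\<close>.\<close>

lemma likelihood_ratio_fun_upd:
  "likelihood_ratio p q \<pi> \<pi>c (Suc n) (fun_upd \<omega> n y) =
     likelihood_ratio p q \<pi> \<pi>c n \<omega> * (\<pi> (fst y) (snd y) / \<pi>c (fst y) (snd y) *
       (case n of 0 \<Rightarrow> 1 | Suc t \<Rightarrow> p (\<omega> t) (fst y) / q (\<omega> t) (fst y)))"
proof (cases n)
  case (Suc t)
  have "(\<Prod>i<Suc t. \<pi> (fst ((fun_upd \<omega> n y) i)) (snd ((fun_upd \<omega> n y) i)) /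
      \<pi>c (fst ((fun_upd \<omega> n y) i)) (snd ((fun_upd \<omega> n y) i))) =
    (\<Prod>i<Suc t. \<pi> (fst (\<omega> i)) (snd (\<omega> i)) / \<pi>c (fst (\<omega> i)) (snd (\<omega> i)))"
    by (rule prod.cong) (auto simp: Suc)
  moreover have "(\<Prod>i<t. p ((fun_upd \<omega> n y) i) (fst ((fun_upd \<omega> n y) (Suc i))) /
      q ((fun_upd \<omega> n y) i) (fst ((fun_upd \<omega> n y) (Suc i)))) =
    (\<Prod>i<t. p (\<omega> i) (fst (\<omega> (Suc i))) / q (\<omega> i) (fst (\<omega> (Suc i))))"
    by (rule prod.cong) (auto simp: Suc)
  ultimately show ?thesis
    unfolding likelihood_ratio_def Suc
    by (simp only: prod.lessThan_Suc[of _ "Suc t"] prod.lessThan_Suc[of _ t] diff_Suc_1 nat.case Suc)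
       (simp add: mult_ac)
qed (simp add: likelihood_ratio_def)

lemma measurable_dynamics_section:
  assumes "transition_dynamics S A q" "x \<in> space (S \<Otimes>\<^sub>M A)"
  shows "q x \<in> borel_measurable S"
  using measurable_compose[OF measurable_Pair1'[OF assms(2)] measurable_dynamics[OF assms(1)]]
  by simp

text \<open>The law of the next state given the past, separated from
  \<open>trajectory_kernel\<close> so that \<open>state_action_dist_ratio_le\<close> becomes
  applicable.\<close>

definition state_dist :: "('s \<times> 'a \<Rightarrow> 's \<Rightarrow> real) \<Rightarrow> nat \<Rightarrow> (nat \<Rightarrow> 's \<times> 'a) \<Rightarrow> 's measure" where
  "state_dist q n \<omega> = (case n of 0 \<Rightarrow> \<mu>0 | Suc t \<Rightarrow> density S (\<lambda>s'. ennreal (q (\<omega> t) s')))"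

lemma trajectory_kernel_eq:
  "trajectory_kernel S A \<mu>0 q \<pi> n \<omega> = state_action_dist A \<pi> (state_dist q n \<omega>)"
  by (simp add: trajectory_kernel_def state_dist_def)

lemma sets_state_dist: "sets (state_dist q n \<omega>) = sets S"
  by (simp add: state_dist_def sets_initial split: nat.split)

lemma prob_space_state_dist:
  assumes "transition_dynamics S A q" "\<omega> \<in> space (PiM {0..<n} (\<lambda>_. S \<Otimes>\<^sub>M A))"
  shows "prob_space (state_dist q n \<omega>)"
proof (cases n)
  case (Suc t)
  then have "\<omega> t \<in> space (S \<Otimes>\<^sub>M A)"
    using assms(2) by (auto simp: space_PiM PiE_iff)
  then show ?thesis
    using prob_space_density_kernel[OF assms(1)] by (simp add: state_dist_def Suc)
qed (simp add: state_dist_def prob_space_initial)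

text \<open>Supplies the hypothesis \<open>step\<close> of
  \<open>nn_integral_lim_change_of_kernel\<close>. The old ratio does not depend on \<open>y\<close>
  and leaves the integral; what remains is a policy ratio times a function of the new state.\<close>

lemma trajectory_kernel_likelihood_ratio_le:
  assumes q: "transition_dynamics S A q" and \<pi>c: "policy S A \<pi>c" and \<pi>: "policy S A \<pi>"
    and \<omega>: "\<omega> \<in> space (PiM {0..<n} (\<lambda>_. S \<Otimes>\<^sub>M A))"
    and g[measurable]: "g \<in> borel_measurable (S \<Otimes>\<^sub>M A)"
  shows "(\<integral>\<^sup>+y. ennreal (likelihood_ratio p q \<pi> \<pi>c (Suc n) (fun_upd \<omega> n y)) * g y
      \<partial>trajectory_kernel S A \<mu>0 q \<pi>c n \<omega>) \<le>
    ennreal (likelihood_ratio p q \<pi> \<pi>c n \<omega>) * (\<integral>\<^sup>+y. g y \<partial>trajectory_kernel S A \<mu>0 p \<pi> n \<omega>)"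
proof -
  \<comment> \<open>The transition part of the new factor. It plays the role of \<open>u\<close> in
    \<open>state_action_dist_ratio_le\<close>, with \<open>\<mu>0\<close> on both sides when
    \<open>n = 0\<close>.\<close>
  define u where "u s = ennreal (case n of 0 \<Rightarrow> 1 | Suc t \<Rightarrow> p (\<omega> t) s / q (\<omega> t) s)" for s
  define \<rho> where "\<rho> y = ennreal (\<pi> (fst y) (snd y) / \<pi>c (fst y) (snd y))" for y
  define K where "K = trajectory_kernel S A \<mu>0 q \<pi>c n \<omega>"
  have sets_K: "sets K = sets (S \<Otimes>\<^sub>M A)"
    unfolding K_def trajectory_kernel_eq by (intro sets_state_action_dist sets_state_dist)
  note [measurable_cong] = sets_K
  have \<omega>t: "\<omega> t \<in> space (S \<Otimes>\<^sub>M A)" if "n = Suc t" for t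
    using \<omega> that by (auto simp: space_PiM PiE_iff)
  have pq[measurable]: "p (\<omega> t) \<in> borel_measurable S" "q (\<omega> t) \<in> borel_measurable S" if "n = Suc t" for t
    using \<omega>t[OF that] by (auto intro!: measurable_dynamics_section dynamics q)
  have u[measurable]: "u \<in> borel_measurable S"
    unfolding u_def[abs_def] using pq by (cases n) simp_all
  note [measurable] = measurable_policy[OF \<pi>c] measurable_policy[OF \<pi>]
  have \<rho>[measurable]: "\<rho> \<in> borel_measurable (S \<Otimes>\<^sub>M A)"
    unfolding \<rho>_def[abs_def] by measurable
  have u_le: "(\<integral>\<^sup>+s. u s * h s \<partial>state_dist q n \<omega>) \<le> (\<integral>\<^sup>+s. h s \<partial>state_dist p n \<omega>)"
    if "h \<in> borel_measurable S" for h
  proof (cases n)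
    case (Suc t)
    show ?thesis
      unfolding u_def state_dist_def Suc nat.case using that pq[OF Suc] \<omega>t[OF Suc] q
      by (intro nn_integral_density_ratio_le) (auto simp: conditional_density_def)
  qed (simp add: u_def state_dist_def)
  have nonneg: "0 \<le> likelihood_ratio p q \<pi> \<pi>c n \<omega>"
    using \<omega> by (intro likelihood_ratio_nonneg q \<pi> \<pi>c) (auto simp: space_PiM PiE_iff)
  have eq: "ennreal (likelihood_ratio p q \<pi> \<pi>c (Suc n) (fun_upd \<omega> n y)) * g y =
      ennreal (likelihood_ratio p q \<pi> \<pi>c n \<omega>) * (\<rho> y * u (fst y) * g y)"
    if "y \<in> space (S \<Otimes>\<^sub>M A)" for y
  proof -
    have "0 \<le> \<pi> (fst y) (snd y) / \<pi>c (fst y) (snd y)"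
      using that \<pi> \<pi>c by (auto simp: conditional_density_def space_pair_measure)
    then show ?thesis
      using nonneg unfolding likelihood_ratio_fun_upd \<rho>_def u_def
      by (simp only: ennreal_mult' mult.assoc)
  qed
  have "(\<integral>\<^sup>+y. ennreal (likelihood_ratio p q \<pi> \<pi>c (Suc n) (fun_upd \<omega> n y)) * g y \<partial>K) =
     (\<integral>\<^sup>+y. ennreal (likelihood_ratio p q \<pi> \<pi>c n \<omega>) * (\<rho> y * u (fst y) * g y) \<partial>K)"
    using eq by (intro nn_integral_cong) (simp add: sets_eq_imp_space_eq[OF sets_K])
  also have "\<dots> = ennreal (likelihood_ratio p q \<pi> \<pi>c n \<omega>) * (\<integral>\<^sup>+y. \<rho> y * u (fst y) * g y \<partial>K)"
    by (rule nn_integral_cmult) measurable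
  also have "\<dots> \<le> ennreal (likelihood_ratio p q \<pi> \<pi>c n \<omega>) *
      (\<integral>\<^sup>+y. g y \<partial>trajectory_kernel S A \<mu>0 p \<pi> n \<omega>)"
    unfolding K_def \<rho>_def trajectory_kernel_eq
    by (intro mult_left_mono state_action_dist_ratio_le \<pi> \<pi>c prob_space_state_dist[OF _ \<omega>]
        sets_state_dist u g u_le q dynamics) auto
  finally show ?thesis by (simp add: K_def)
qed

lemma nn_integral_trajectory_likelihood_ratio_le:
  assumes q: "transition_dynamics S A q" and \<pi>c: "policy S A \<pi>c" and \<pi>: "policy S A \<pi>"
    and f: "f \<in> borel_measurable (PiM {0..<n} (\<lambda>_. S \<Otimes>\<^sub>M A))"
  shows "(\<integral>\<^sup>+\<tau>. ennreal (likelihood_ratio p q \<pi> \<pi>c n (restrict \<tau> {0..<n})) * f (restrict \<tau> {0..<n})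
            \<partial>trajectory_dist S A \<mu>0 q \<pi>c) \<le>
         (\<integral>\<^sup>+\<tau>. f (restrict \<tau> {0..<n}) \<partial>trajectory_dist S A \<mu>0 p \<pi>)"
  unfolding trajectory_dist_def
proof (rule nn_integral_lim_change_of_kernel)
  show "Ionescu_Tulcea (trajectory_kernel S A \<mu>0 q \<pi>c) (\<lambda>_. S \<Otimes>\<^sub>M A)"
    using mdp_axioms q \<pi>c by (rule Ionescu_Tulcea_trajectory)
  show "Ionescu_Tulcea (trajectory_kernel S A \<mu>0 p \<pi>) (\<lambda>_. S \<Otimes>\<^sub>M A)"
    using mdp_axioms dynamics \<pi> by (rule Ionescu_Tulcea_trajectory)
  show "(\<lambda>\<omega>. ennreal (likelihood_ratio p q \<pi> \<pi>c n \<omega>)) \<in> borel_measurable (PiM {0..<n} (\<lambda>_. S \<Otimes>\<^sub>M A))" for n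
    by (intro measurable_compose[OF measurable_likelihood_ratio measurable_ennreal] q \<pi> \<pi>c) auto
  show "ennreal (likelihood_ratio p q \<pi> \<pi>c 0 \<omega>) \<le> 1" for \<omega>
    by (simp add: likelihood_ratio_def)
qed (intro trajectory_kernel_likelihood_ratio_le q \<pi> \<pi>c f; assumption)+

text \<open>The shifts-aware term at time \<open>n\<close> also looks at the state at time
  \<open>Suc n\<close>, through a transition ratio that \<open>likelihood_ratio\<close> omits. Given
  the first \<open>Suc n\<close> pairs, the expectation of that ratio under \<open>q\<close> is at
  most 1, so it can be integrated out.\<close>

lemma nn_integral_trajectory_likelihood_ratio_transition_le:
  assumes q: "transition_dynamics S A q" and \<pi>c: "policy S A \<pi>c" and \<pi>: "policy S A \<pi>"
    and f: "f \<in> borel_measurable (PiM {0..<Suc n} (\<lambda>_. S \<Otimes>\<^sub>M A))"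
  shows "(\<integral>\<^sup>+\<tau>. ennreal (likelihood_ratio p q \<pi> \<pi>c (Suc n) (restrict \<tau> {0..<Suc n})) *
              f (restrict \<tau> {0..<Suc n}) * ennreal (p (\<tau> n) (fst (\<tau> (Suc n))) / q (\<tau> n) (fst (\<tau> (Suc n))))
            \<partial>trajectory_dist S A \<mu>0 q \<pi>c) \<le>
         (\<integral>\<^sup>+\<tau>. f (restrict \<tau> {0..<Suc n}) \<partial>trajectory_dist S A \<mu>0 p \<pi>)"
proof -
  interpret Q: Ionescu_Tulcea "trajectory_kernel S A \<mu>0 q \<pi>c" "\<lambda>_. S \<Otimes>\<^sub>M A"
    using mdp_axioms q \<pi>c by (rule Ionescu_Tulcea_trajectory)
  note [measurable] = measurable_dynamics[OF q] measurable_dynamics[OF dynamics] f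
  define F where "F \<omega> = ennreal (likelihood_ratio p q \<pi> \<pi>c (Suc n) \<omega>) * f \<omega>" for \<omega>
  define c where "c x s = ennreal (p x s / q x s)" for x s
  have c[measurable]: "(\<lambda>(x, s). c x s) \<in> borel_measurable ((S \<Otimes>\<^sub>M A) \<Otimes>\<^sub>M S)"
    unfolding c_def by measurable
  have lr: "likelihood_ratio p q \<pi> \<pi>c (Suc n) \<in> borel_measurable (PiM {0..<k} (\<lambda>_. S \<Otimes>\<^sub>M A))"
    if "n < k" for k
    using that by (intro measurable_likelihood_ratio q \<pi>c \<pi>) auto
  have F: "F \<in> borel_measurable (PiM {0..<Suc n} (\<lambda>_. S \<Otimes>\<^sub>M A))"
    unfolding F_def using lr[of "Suc n"] by measurable
  \<comment> \<open>The integrand as a function of the first \<open>Suc (Suc n)\<close> coordinates,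
    in the form needed to disintegrate the last one.\<close>
  define G where "G \<xi> = F (restrict \<xi> {0..<Suc n}) * c (\<xi> n) (fst (\<xi> (Suc n)))" for \<xi>
  have G: "G \<in> borel_measurable (PiM {0..<Suc (Suc n)} (\<lambda>_. S \<Otimes>\<^sub>M A))"
  proof -
    have [measurable]: "(\<lambda>\<xi>. F (restrict \<xi> {0..<Suc n})) \<in> borel_measurable (PiM {0..<Suc (Suc n)} (\<lambda>_. S \<Otimes>\<^sub>M A))"
      by (rule measurable_compose[OF measurable_restrict_subset F]) auto
    have [measurable]: "(\<lambda>\<xi>. \<xi> n) \<in> measurable (PiM {0..<Suc (Suc n)} (\<lambda>_. S \<Otimes>\<^sub>M A)) (S \<Otimes>\<^sub>M A)"
      "(\<lambda>\<xi>. \<xi> (Suc n)) \<in> measurable (PiM {0..<Suc (Suc n)} (\<lambda>_. S \<Otimes>\<^sub>M A)) (S \<Otimes>\<^sub>M A)"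
      by (auto intro!: measurable_component_singleton)
    show ?thesis
      unfolding G_def[abs_def] by measurable
  qed
  have "(\<integral>\<^sup>+\<tau>. F (restrict \<tau> {0..<Suc n}) * c (\<tau> n) (fst (\<tau> (Suc n))) \<partial>Q.PF.lim) =
      (\<integral>\<^sup>+\<tau>. G (restrict \<tau> {0..<Suc (Suc n)}) \<partial>Q.PF.lim)"
    by (intro nn_integral_cong) (simp add: G_def restrict_restrict Int_absorb1 cong: restrict_cong)
  also have "\<dots> = (\<integral>\<^sup>+\<tau>. (\<integral>\<^sup>+y. G (fun_upd (restrict \<tau> {0..<Suc n}) (Suc n) y)
      \<partial>trajectory_kernel S A \<mu>0 q \<pi>c (Suc n) (restrict \<tau> {0..<Suc n})) \<partial>Q.PF.lim)"
    using G by (rule Q.nn_integral_lim_Suc)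
  also have "\<dots> \<le> (\<integral>\<^sup>+\<tau>. F (restrict \<tau> {0..<Suc n}) \<partial>Q.PF.lim)"
  proof (rule nn_integral_mono)
    fix \<tau> assume "\<tau> \<in> space Q.PF.lim"
    then have \<omega>: "restrict \<tau> {0..<Suc n} \<in> space (PiM {0..<Suc n} (\<lambda>_. S \<Otimes>\<^sub>M A))"
      and \<tau>n: "\<tau> n \<in> space (S \<Otimes>\<^sub>M A)"
      by (auto simp: Q.PF.space_lim space_PiM)
    let ?\<omega> = "restrict \<tau> {0..<Suc n}"
    let ?K = "trajectory_kernel S A \<mu>0 q \<pi>c (Suc n) ?\<omega>"
    have sets_K: "sets ?K = sets (S \<Otimes>\<^sub>M A)"
      unfolding trajectory_kernel_eq by (intro sets_state_action_dist sets_state_dist)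
    note [measurable_cong] = sets_K
    have [measurable]: "p (\<tau> n) \<in> borel_measurable S" "q (\<tau> n) \<in> borel_measurable S"
      using \<tau>n by (auto intro!: measurable_dynamics_section dynamics q)
    then have [measurable]: "c (\<tau> n) \<in> borel_measurable S"
      unfolding c_def[abs_def] by measurable
    have "(\<integral>\<^sup>+y. G (fun_upd ?\<omega> (Suc n) y) \<partial>?K) = (\<integral>\<^sup>+y. F ?\<omega> * c (\<tau> n) (fst y) \<partial>?K)"
    proof (intro nn_integral_cong)
      fix y
      have "restrict (fun_upd ?\<omega> (Suc n) y) {0..<Suc n} = ?\<omega>"
        by (auto simp: restrict_def)
      then show "G (fun_upd ?\<omega> (Suc n) y) = F ?\<omega> * c (\<tau> n) (fst y)"
        unfolding G_def by simp
    qed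
    also have "\<dots> = F ?\<omega> * (\<integral>\<^sup>+y. c (\<tau> n) (fst y) \<partial>?K)"
      by (rule nn_integral_cmult) measurable
    also have "(\<integral>\<^sup>+y. c (\<tau> n) (fst y) \<partial>?K) = (\<integral>\<^sup>+s. \<integral>\<^sup>+a. ennreal (\<pi>c s a) * c (\<tau> n) s \<partial>A \<partial>state_dist q (Suc n) ?\<omega>)"
      unfolding trajectory_kernel_eq
      by (subst nn_integral_state_action_dist[OF sigma_finite_actions \<pi>c prob_space_state_dist[OF q \<omega>]
            sets_state_dist]) simp_all
    \<comment> \<open>The transition ratio does not involve the new action, so \<open>\<pi>c\<close>
      integrates to 1.\<close>
    also have "\<dots> = (\<integral>\<^sup>+s. c (\<tau> n) s * 1 \<partial>state_dist q (Suc n) ?\<omega>)"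
    proof (rule nn_integral_cong)
      fix s assume "s \<in> space (state_dist q (Suc n) ?\<omega>)"
      then have s: "s \<in> space S" using sets_eq_imp_space_eq[OF sets_state_dist] by auto
      then have "(\<lambda>a. \<pi>c s a) \<in> borel_measurable A"
        using measurable_compose[OF measurable_Pair1'[OF s] measurable_policy[OF \<pi>c]] by simp
      then have "(\<integral>\<^sup>+a. ennreal (\<pi>c s a) * c (\<tau> n) s \<partial>A) = (\<integral>\<^sup>+a. ennreal (\<pi>c s a) \<partial>A) * c (\<tau> n) s"
        by (intro nn_integral_multc) simp
      then show "(\<integral>\<^sup>+a. ennreal (\<pi>c s a) * c (\<tau> n) s \<partial>A) = c (\<tau> n) s * 1"
        using s \<pi>c by (simp add: conditional_density_def)
    qed
    \<comment> \<open>Cancelling \<open>q\<close> leaves at most the total mass of the density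
      \<open>p (\<tau> n)\<close>.\<close>
    also have "\<dots> \<le> (\<integral>\<^sup>+s. 1 \<partial>density S (\<lambda>s. ennreal (p (\<tau> n) s)))"
      unfolding state_dist_def c_def using \<tau>n q
      by (simp del: mult_1_right nn_integral_const, intro nn_integral_density_ratio_le)
         (auto simp: conditional_density_def)
    also have "\<dots> = 1"
      using prob_space.emeasure_space_1[OF prob_space_density_kernel[OF dynamics \<tau>n]] by simp
    finally show "(\<integral>\<^sup>+y. G (fun_upd ?\<omega> (Suc n) y) \<partial>?K) \<le> F ?\<omega>"
      by (metis mult.right_neutral mult_left_mono zero_le)
  qed
  also have "\<dots> \<le> (\<integral>\<^sup>+\<tau>. f (restrict \<tau> {0..<Suc n}) \<partial>trajectory_dist S A \<mu>0 p \<pi>)"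
    using nn_integral_trajectory_likelihood_ratio_le[OF q \<pi>c \<pi> f]
    unfolding F_def trajectory_dist_def .
  finally show ?thesis
    unfolding F_def c_def trajectory_dist_def .
qed


lemma trajectory_dist_PiM:
  assumes "transition_dynamics S A q" "policy S A \<pi>"
  shows sets_trajectory_dist: "sets (trajectory_dist S A \<mu>0 q \<pi>) = sets (PiM UNIV (\<lambda>_. S \<Otimes>\<^sub>M A))"
    and space_trajectory_dist: "space (trajectory_dist S A \<mu>0 q \<pi>) = space (PiM UNIV (\<lambda>_. S \<Otimes>\<^sub>M A))"
    and prob_space_trajectory_dist: "prob_space (trajectory_dist S A \<mu>0 q \<pi>)"
proof -
  interpret Q: Ionescu_Tulcea "trajectory_kernel S A \<mu>0 q \<pi>" "\<lambda>_. S \<Otimes>\<^sub>M A"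
    using mdp_axioms assms by (rule Ionescu_Tulcea_trajectory)
  show "sets (trajectory_dist S A \<mu>0 q \<pi>) = sets (PiM UNIV (\<lambda>_. S \<Otimes>\<^sub>M A))"
    "space (trajectory_dist S A \<mu>0 q \<pi>) = space (PiM UNIV (\<lambda>_. S \<Otimes>\<^sub>M A))"
    "prob_space (trajectory_dist S A \<mu>0 q \<pi>)"
    unfolding trajectory_dist_def
    using Q.PF.sets_lim Q.PF.space_lim Q.prob_space_lim by simp_all
qed

section \<open>Pathwise estimates and passage to the infinite horizon\<close>

text \<open>\<open>exp_weighted_sum_le\<close> at the points \<open>ln (x t)\<close>: the weights
  miss total mass 1 by \<open>\<gamma> ^ n\<close>, and positivity allows the partial sum to be
  replaced by the full series.\<close>

lemma weighted_geometric_reward_le: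
  fixes x :: "nat \<Rightarrow> real"
  assumes pos: "\<And>t. 0 < x t" and sm: "summable (\<lambda>t. \<gamma> ^ t * x t)"
  shows "exp (\<Sum>t<n. (1 - \<gamma>) * \<gamma> ^ t * ln (x t)) \<le> (1 - \<gamma>) * (\<Sum>t. \<gamma> ^ t * x t) + \<gamma> ^ n"
proof -
  have w: "(\<Sum>t<n. (1 - \<gamma>) * \<gamma> ^ t) = 1 - \<gamma> ^ n"
    by (simp add: one_diff_power_eq sum_distrib_left)
  have "exp (\<Sum>t<n. (1 - \<gamma>) * \<gamma> ^ t * ln (x t)) \<le>
      (\<Sum>t<n. (1 - \<gamma>) * \<gamma> ^ t * exp (ln (x t))) + (1 - (\<Sum>t<n. (1 - \<gamma>) * \<gamma> ^ t))"
    using discount by (intro exp_weighted_sum_le) (auto simp: w)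
  also have "\<dots> = (1 - \<gamma>) * (\<Sum>t<n. \<gamma> ^ t * x t) + \<gamma> ^ n"
    unfolding w using pos by (simp add: sum_distrib_left mult.assoc)
  also have "\<dots> \<le> (1 - \<gamma>) * (\<Sum>t. \<gamma> ^ t * x t) + \<gamma> ^ n"
    using discount pos by (intro add_mono mult_left_mono sum_le_suminf sm) (auto intro: less_imp_le)
  finally show ?thesis .
qed

text \<open>The prefactor \<open>1 / ((1 - \<gamma>) * \<gamma> ^ t)\<close> in the reward undoes
  the discounting of the log-ratios, so they add up to the logarithm of a plain product. The last
  factor is the transition ratio that \<open>likelihood_ratio\<close> omits.\<close>

lemma exp_shifts_aware_partial_sum:
  assumes pos: "\<And>t. 0 < p (\<tau> t) (fst (\<tau> (Suc t)))" "\<And>t. 0 < q (\<tau> t) (fst (\<tau> (Suc t)))"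
    "\<And>t. 0 < \<pi> (fst (\<tau> t)) (snd (\<tau> t))" "\<And>t. 0 < \<pi>c (fst (\<tau> t)) (snd (\<tau> t))"
  shows "exp ((1 - \<gamma>) * (\<Sum>t<Suc n. shifts_aware_term \<gamma> r p q \<pi> \<pi>c \<tau> t)) =
    likelihood_ratio p q \<pi> \<pi>c (Suc n) \<tau> *
    exp (\<Sum>t<Suc n. (1 - \<gamma>) * \<gamma> ^ t * ln (r (\<tau> t))) *
    (p (\<tau> n) (fst (\<tau> (Suc n))) / q (\<tau> n) (fst (\<tau> (Suc n))))"
proof -
  define P where "P t = p (\<tau> t) (fst (\<tau> (Suc t))) / q (\<tau> t) (fst (\<tau> (Suc t)))" for t
  define R where "R t = \<pi> (fst (\<tau> t)) (snd (\<tau> t)) / \<pi>c (fst (\<tau> t)) (snd (\<tau> t))" for t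
  have P: "0 < P t" and R: "0 < R t" for t
    using pos by (simp_all add: P_def R_def)
  have "(1 - \<gamma>) * shifts_aware_term \<gamma> r p q \<pi> \<pi>c \<tau> t =
      (1 - \<gamma>) * \<gamma> ^ t * ln (r (\<tau> t)) + (ln (P t) + ln (R t))" for t
    using discount by (simp add: shifts_aware_reward_def P_def R_def field_simps)
  then have "exp ((1 - \<gamma>) * (\<Sum>t<Suc n. shifts_aware_term \<gamma> r p q \<pi> \<pi>c \<tau> t)) =
      exp (\<Sum>t<Suc n. (1 - \<gamma>) * \<gamma> ^ t * ln (r (\<tau> t))) * exp (\<Sum>t<Suc n. ln (P t) + ln (R t))"
    by (simp only: sum_distrib_left sum.distrib[of "\<lambda>t. (1 - \<gamma>) * \<gamma> ^ t * ln (r (\<tau> t))"] exp_add)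
  also have "exp (\<Sum>t<Suc n. ln (P t) + ln (R t)) = (\<Prod>t<Suc n. P t) * (\<Prod>t<Suc n. R t)"
    unfolding prod.distrib[symmetric] exp_sum[OF finite_lessThan] using P R by (simp add: exp_add)
  finally show ?thesis
    unfolding likelihood_ratio_def P_def[symmetric] R_def[symmetric] by simp
qed

lemma exp_surrogate_objective_le:
  assumes r_pos: "\<And>s a. s \<in> space S \<Longrightarrow> a \<in> space A \<Longrightarrow> r (s, a) > 0"
    and q: "transition_dynamics S A q" and \<pi>c: "policy S A \<pi>c" and \<pi>: "policy S A \<pi>"
    and supp: "AE \<tau> in trajectory_dist S A \<mu>0 q \<pi>c. \<forall>t.
           p (\<tau> t) (fst (\<tau> (Suc t))) \<noteq> 0 \<and> q (\<tau> t) (fst (\<tau> (Suc t))) \<noteq> 0 \<and>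
           \<pi> (fst (\<tau> t)) (snd (\<tau> t)) \<noteq> 0 \<and> \<pi>c (fst (\<tau> t)) (snd (\<tau> t)) \<noteq> 0"
    and sm_r: "AE \<tau> in trajectory_dist S A \<mu>0 p \<pi>. summable (\<lambda>t. \<gamma> ^ t * r (\<tau> t))"
    and int_r: "integrable (trajectory_dist S A \<mu>0 p \<pi>) (discounted_return \<gamma> r)"
    and sm_s: "AE \<tau> in trajectory_dist S A \<mu>0 q \<pi>c. summable (shifts_aware_term \<gamma> r p q \<pi> \<pi>c \<tau>)"
    and int_s: "integrable (trajectory_dist S A \<mu>0 q \<pi>c) (shifts_aware_return \<gamma> r p q \<pi> \<pi>c)"
  shows "exp ((1 - \<gamma>) * surrogate_objective S A p r \<mu>0 \<gamma> q \<pi>c \<pi>) \<le>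
    (1 - \<gamma>) * expected_return S A p r \<mu>0 \<gamma> \<pi>"
proof -
  define Q where "Q = trajectory_dist S A \<mu>0 q \<pi>c"
  define P where "P = trajectory_dist S A \<mu>0 p \<pi>"
  interpret Q: prob_space Q
    unfolding Q_def using q \<pi>c by (rule prob_space_trajectory_dist)
  interpret P: prob_space P
    unfolding P_def using dynamics \<pi> by (rule prob_space_trajectory_dist)
  note [measurable_cong] = sets_trajectory_dist[OF q \<pi>c, folded Q_def]
    sets_trajectory_dist[OF dynamics \<pi>, folded P_def]
  note [measurable] = measurable_dynamics[OF q] measurable_dynamics[OF dynamics] measurable_reward
  have space_QP: "\<tau> t \<in> space (S \<Otimes>\<^sub>M A)" if "\<tau> \<in> space Q \<or> \<tau> \<in> space P" for \<tau> t
    using that space_trajectory_dist[OF q \<pi>c] space_trajectory_dist[OF dynamics \<pi>]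
    by (auto simp: Q_def P_def space_PiM)
  have r_pos': "0 < r x" if "x \<in> space (S \<Otimes>\<^sub>M A)" for x
    using that r_pos by (auto simp: space_pair_measure)
  define J where "J = expected_return S A p r \<mu>0 \<gamma> \<pi>"
  have J: "J = (\<integral>\<tau>. discounted_return \<gamma> r \<tau> \<partial>P)"
    by (simp add: J_def expected_return_def P_def)
  define X where "X \<tau> = (1 - \<gamma>) * shifts_aware_return \<gamma> r p q \<pi> \<pi>c \<tau>" for \<tau>
  have X: "integrable Q X" "Q.expectation X = (1 - \<gamma>) * surrogate_objective S A p r \<mu>0 \<gamma> q \<pi>c \<pi>"
    using int_s by (simp_all add: X_def[abs_def] surrogate_objective_def Q_def)
  define f where "f n \<omega> = ennreal (exp (\<Sum>t<Suc n. (1 - \<gamma>) * \<gamma> ^ t * ln (r (\<omega> t))))"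
    for n and \<omega> :: "nat \<Rightarrow> 's \<times> 'a"
  have f[measurable]: "f n \<in> borel_measurable (PiM {0..<Suc n} (\<lambda>_. S \<Otimes>\<^sub>M A))" for n
  proof -
    have "(\<lambda>\<omega>. \<Sum>t<Suc n. (1 - \<gamma>) * \<gamma> ^ t * ln (r (\<omega> t))) \<in> borel_measurable (PiM {0..<Suc n} (\<lambda>_. S \<Otimes>\<^sub>M A))"
    proof (rule borel_measurable_sum)
      fix t assume "t \<in> {..<Suc n}"
      then have [measurable]: "(\<lambda>\<omega>. \<omega> t) \<in> measurable (PiM {0..<Suc n} (\<lambda>_. S \<Otimes>\<^sub>M A)) (S \<Otimes>\<^sub>M A)"
        by (intro measurable_component_singleton) simp
      show "(\<lambda>\<omega>. (1 - \<gamma>) * \<gamma> ^ t * ln (r (\<omega> t))) \<in> borel_measurable (PiM {0..<Suc n} (\<lambda>_. S \<Otimes>\<^sub>M A))"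
        by measurable
    qed
    then show ?thesis
      unfolding f_def[abs_def] by measurable
  qed
  have f_restrict: "f n (restrict \<tau> {0..<Suc n}) = f n \<tau>" for n \<tau>
    unfolding f_def by (intro arg_cong[where f="\<lambda>x. ennreal (exp x)"] sum.cong) auto
  \<comment> \<open>Indexed so that \<open>Z n\<close> covers \<open>Suc n\<close> terms, and
    written as the integrand of
    \<open>nn_integral_trajectory_likelihood_ratio_transition_le\<close>. Its identification with
    the exponential of a partial sum uses positive ratios and is made only almost everywhere, inside
    \<open>Z_lim\<close>.\<close>
  define Z where "Z n \<tau> = ennreal (likelihood_ratio p q \<pi> \<pi>c (Suc n) (restrict \<tau> {0..<Suc n})) *
    f n (restrict \<tau> {0..<Suc n}) * ennreal (p (\<tau> n) (fst (\<tau> (Suc n))) / q (\<tau> n) (fst (\<tau> (Suc n))))"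
    for n \<tau>
  have Z[measurable]: "Z n \<in> borel_measurable Q" for n
  proof -
    have [measurable]: "(\<lambda>\<tau>. restrict \<tau> {0..<Suc n}) \<in> measurable Q (PiM {0..<Suc n} (\<lambda>_. S \<Otimes>\<^sub>M A))"
      by (simp add: measurable_cong_sets[OF sets_trajectory_dist[OF q \<pi>c, folded Q_def] refl]
          measurable_restrict_subset)
    have [measurable]: "likelihood_ratio p q \<pi> \<pi>c (Suc n) \<in> borel_measurable (PiM {0..<Suc n} (\<lambda>_. S \<Otimes>\<^sub>M A))"
      by (intro measurable_likelihood_ratio q \<pi>c \<pi>) auto
    show ?thesis
      unfolding Z_def[abs_def] by measurable
  qed
  have Z_lim: "AE \<tau> in Q. liminf (\<lambda>n. Z n \<tau>) = ennreal (exp (X \<tau>))"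
    using supp[folded Q_def] sm_s[folded Q_def] AE_space
  proof eventually_elim
    case (elim \<tau>)
    have sp: "\<tau> t \<in> space (S \<Otimes>\<^sub>M A)" "fst (\<tau> t) \<in> space S" "snd (\<tau> t) \<in> space A" for t
      using space_QP[of \<tau> t] elim(3) by (auto simp: space_pair_measure)
    have pos: "0 < p (\<tau> t) (fst (\<tau> (Suc t)))" "0 < q (\<tau> t) (fst (\<tau> (Suc t)))"
      "0 < \<pi> (fst (\<tau> t)) (snd (\<tau> t))" "0 < \<pi>c (fst (\<tau> t)) (snd (\<tau> t))" for t
      using elim(1) sp dynamics q \<pi> \<pi>c by (simp_all add: conditional_density_def less_le)
    have lr: "likelihood_ratio p q \<pi> \<pi>c (Suc n) (restrict \<tau> {0..<Suc n}) =
        likelihood_ratio p q \<pi> \<pi>c (Suc n) \<tau>" for n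
      unfolding likelihood_ratio_def by (intro arg_cong2[where f="(*)"] prod.cong) auto
    have lr0: "0 \<le> likelihood_ratio p q \<pi> \<pi>c (Suc n) \<tau>" for n
      by (intro likelihood_ratio_nonneg q \<pi> \<pi>c sp)
    have Z_eq: "Z n \<tau> = ennreal (exp ((1 - \<gamma>) * (\<Sum>t<Suc n. shifts_aware_term \<gamma> r p q \<pi> \<pi>c \<tau> t)))" for n
      unfolding exp_shifts_aware_partial_sum[where \<tau>=\<tau> and q=q and \<pi>=\<pi> and \<pi>c=\<pi>c, OF pos] Z_def f_restrict lr
      using lr0[of n] by (simp only: f_def ennreal_mult' mult_nonneg_nonneg exp_ge_zero)
    have "(\<lambda>n. \<Sum>t<Suc n. shifts_aware_term \<gamma> r p q \<pi> \<pi>c \<tau> t) \<longlonglongrightarrow> shifts_aware_return \<gamma> r p q \<pi> \<pi>c \<tau>"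
      using summable_LIMSEQ[OF elim(2)] unfolding shifts_aware_return_def by (rule LIMSEQ_Suc)
    then have "(\<lambda>n. Z n \<tau>) \<longlonglongrightarrow> ennreal (exp (X \<tau>))"
      unfolding Z_eq X_def by (intro tendsto_intros)
    then show ?case
      by (simp add: lim_imp_Liminf)
  qed
  have Z_le: "(\<integral>\<^sup>+\<tau>. Z n \<tau> \<partial>Q) \<le> ennreal ((1 - \<gamma>) * J + \<gamma> ^ Suc n)" for n
  proof -
    have "(\<integral>\<^sup>+\<tau>. Z n \<tau> \<partial>Q) \<le> (\<integral>\<^sup>+\<tau>. f n (restrict \<tau> {0..<Suc n}) \<partial>P)"
      unfolding Z_def Q_def P_def by (intro nn_integral_trajectory_likelihood_ratio_transition_le q \<pi>c \<pi> f)
    \<comment> \<open>After the change of law only rewards are left, and the AM-GM bound holds along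
      \<open>P\<close>-almost every trajectory.\<close>
    also have "\<dots> \<le> (\<integral>\<^sup>+\<tau>. ennreal ((1 - \<gamma>) * discounted_return \<gamma> r \<tau> + \<gamma> ^ Suc n) \<partial>P)"
    proof (rule nn_integral_mono_AE)
      show "AE \<tau> in P. f n (restrict \<tau> {0..<Suc n}) \<le>
          ennreal ((1 - \<gamma>) * discounted_return \<gamma> r \<tau> + \<gamma> ^ Suc n)"
        using sm_r[folded P_def] AE_space
      proof eventually_elim
        case (elim \<tau>)
        have "0 < r (\<tau> t)" for t using elim(2) by (intro r_pos' space_QP) simp
        then show ?case
          unfolding f_restrict unfolding f_def discounted_return_def
          by (intro ennreal_leI weighted_geometric_reward_le elim(1))
      qed
    qed
    also have "\<dots> = ennreal (\<integral>\<tau>. (1 - \<gamma>) * discounted_return \<gamma> r \<tau> + \<gamma> ^ Suc n \<partial>P)"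
    proof (rule nn_integral_eq_integral)
      show "integrable P (\<lambda>\<tau>. (1 - \<gamma>) * discounted_return \<gamma> r \<tau> + \<gamma> ^ Suc n)"
        using int_r by (simp add: P_def[symmetric])
      show "AE \<tau> in P. 0 \<le> (1 - \<gamma>) * discounted_return \<gamma> r \<tau> + \<gamma> ^ Suc n"
        using sm_r[folded P_def] AE_space
      proof eventually_elim
        case (elim \<tau>)
        have "0 < r (\<tau> t)" for t using elim(2) by (intro r_pos' space_QP) simp
        then have "0 \<le> discounted_return \<gamma> r \<tau>"
          unfolding discounted_return_def using discount
          by (intro suminf_nonneg elim(1)) (simp add: less_imp_le)
        then show ?case using discount by simp
      qed
    qed
    also have "(\<integral>\<tau>. (1 - \<gamma>) * discounted_return \<gamma> r \<tau> + \<gamma> ^ Suc n \<partial>P) = (1 - \<gamma>) * J + \<gamma> ^ Suc n"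
      using int_r by (simp add: P_def[symmetric] J P.prob_space)
    finally show ?thesis .
  qed
  have "ennreal (exp (Q.expectation X)) \<le> (\<integral>\<^sup>+\<tau>. ennreal (exp (X \<tau>)) \<partial>Q)"
    using X(1) by (rule Q.jensen_exp_nn_integral)
  also have "\<dots> = (\<integral>\<^sup>+\<tau>. liminf (\<lambda>n. Z n \<tau>) \<partial>Q)"
    using Z_lim by (intro nn_integral_cong_AE) auto
  \<comment> \<open>Fatou's lemma carries the bounds \<open>Z_le\<close> to the limit without a
    dominating function.\<close>
  also have "\<dots> \<le> liminf (\<lambda>n. \<integral>\<^sup>+\<tau>. Z n \<tau> \<partial>Q)"
    by (rule nn_integral_liminf) measurable
  also have "\<dots> \<le> liminf (\<lambda>n. ennreal ((1 - \<gamma>) * J + \<gamma> ^ Suc n))"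
    using Z_le by (intro Liminf_mono always_eventually) auto
  also have "\<dots> = ennreal ((1 - \<gamma>) * J + 0)"
    using discount by (intro lim_imp_Liminf tendsto_intros LIMSEQ_Suc LIMSEQ_power_zero) auto
  \<comment> \<open>Positivity of \<open>exp\<close> excludes the case in which
    \<open>ennreal\<close> truncates a negative right side.\<close>
  finally have "exp (Q.expectation X) \<le> (1 - \<gamma>) * J"
    by (simp add: ennreal_le_iff2 not_le[symmetric])
  then show ?thesis by (simp add: X(2) J_def)
qed

end

theorem theorem1:
  fixes S :: "'s measure" and A :: "'a measure"
    and p q :: "'s \<times> 'a \<Rightarrow> 's \<Rightarrow> real" and r :: "'s \<times> 'a \<Rightarrow> real"
    and \<mu>0 :: "'s measure" and \<gamma> :: real and \<pi> \<pi>c :: "'s \<Rightarrow> 'a \<Rightarrow> real"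
  assumes "mdp S A p r \<mu>0 \<gamma>"
    and "\<And>s a. s \<in> space S \<Longrightarrow> a \<in> space A \<Longrightarrow> r (s, a) > 0"
    and "transition_dynamics S A q"
    and "policy S A \<pi>c"
    and "policy S A \<pi>"
    and "AE \<tau> in trajectory_dist S A \<mu>0 q \<pi>c. \<forall>t.
           p (\<tau> t) (fst (\<tau> (Suc t))) \<noteq> 0 \<and> q (\<tau> t) (fst (\<tau> (Suc t))) \<noteq> 0 \<and>
           \<pi> (fst (\<tau> t)) (snd (\<tau> t)) \<noteq> 0 \<and> \<pi>c (fst (\<tau> t)) (snd (\<tau> t)) \<noteq> 0"
    and "AE \<tau> in trajectory_dist S A \<mu>0 p \<pi>. summable (\<lambda>t. \<gamma> ^ t * r (\<tau> t))"
    and "integrable (trajectory_dist S A \<mu>0 p \<pi>) (discounted_return \<gamma> r)"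
    and "AE \<tau> in trajectory_dist S A \<mu>0 q \<pi>c. summable (shifts_aware_term \<gamma> r p q \<pi> \<pi>c \<tau>)"
    and "integrable (trajectory_dist S A \<mu>0 q \<pi>c) (shifts_aware_return \<gamma> r p q \<pi> \<pi>c)"
  shows "ln (expected_return S A p r \<mu>0 \<gamma> \<pi>)
           \<ge> (1 - \<gamma>) * surrogate_objective S A p r \<mu>0 \<gamma> q \<pi>c \<pi>"
proof -
  interpret mdp S A p r \<mu>0 \<gamma> by fact
  define L where "L = (1 - \<gamma>) * surrogate_objective S A p r \<mu>0 \<gamma> q \<pi>c \<pi>"
  define J where "J = expected_return S A p r \<mu>0 \<gamma> \<pi>"
  have le: "exp L \<le> (1 - \<gamma>) * J"
    unfolding L_def J_def using assms(2-) by (rule exp_surrogate_objective_le)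
  then have "0 < (1 - \<gamma>) * J"
    using exp_gt_zero[of L] by linarith
  then have J: "0 < J"
    using discount by (simp add: zero_less_mult_iff)
  \<comment> \<open>The factor \<open>1 - \<gamma>\<close> is at most 1 and \<open>J\<close> is
    positive, so it may be dropped.\<close>
  then have "exp L \<le> J"
    using le discount by (smt (verit) mult_left_le_one_le)
  then have "L \<le> ln J"
    using J by (simp add: ln_ge_iff)
  then show ?thesis by (simp add: L_def J_def)
qed

end
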